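(* Let $G$ be a finite tree in which there exists a (simple) path containing all vertices of $G$ of degree $3$ or more. Then $G$ is friendly to the simple path; that is, the edges of $G$ can be numbered bijectively by $1,2,\ldots,|E(G)|$ so that for every $k$ with $1\le k<|E(G)|$ and every $s\in\mathbb Z$, the path in $G$ between the edges numbered $k$ and $k+1$ contains either both of the edges numbered $k+2s$ and $k+2s+1$, or neither of them.
   Context: All trees are finite. The path between two distinct edges of a tree is the path that joins some endpoint of the first edge to some endpoint of the second edge and contains neither of the two edges; it exists and is unique (it may have zero edges). If a number is outside $\{1,\ldots,|E(G)|\}$, there is no edge with that number, so it counts as not contained in the path. A tree is called friendly to the simple path if its edges admit a numbering with the property displayed in the claim. *)

theory Defs
  imports "Graph_Theory.Digraph_Component_Vwalk"
begin

text \<open>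
  A finite simple graph is a \<^locale>\<open>pair_graph\<close>: a finite vertex set with a
  finite, symmetric, irreflexive set of arcs.  The undirected edge joining \<open>u\<close> and \<open>v\<close>
  is the set \<open>{u, v}\<close>; it stands for the two arcs \<open>(u, v)\<close> and \<open>(v, u)\<close>.
  A simple path is a \<^const>\<open>vpath\<close>, the list of its vertices, and the degree of a
  vertex is its \<^const>\<open>out_degree\<close> (see \<open>out_degree_eq_incident_edges\<close>).
\<close>

definition edge_of :: "'a \<times> 'a \<Rightarrow> 'a set" where
  "edge_of a = {fst a, snd a}"

definition edges :: "'a pair_pre_digraph \<Rightarrow> 'a set set" where
  "edges G = edge_of ` parcs G"

definition path_edges :: "'a list \<Rightarrow> 'a set set" where
  "path_edges p = edge_of ` set (vwalk_arcs p)"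

text \<open>
  The library's \<^const>\<open>forest\<close> and \<^const>\<open>tree\<close> are not usable here: they count
  the closed walk \<open>u, v, u\<close> as a cycle, so that a symmetric digraph with an arc is never
  a forest.  In a \<^locale>\<open>pair_graph\<close> the undirected cycles are the
  directed cycles of length at least 3.
\<close>

definition undirected_tree :: "'a pair_pre_digraph \<Rightarrow> bool" where
  "undirected_tree G \<longleftrightarrow>
     pair_graph G \<and> connected (with_proj G) \<and>
     \<not> (\<exists>c. pre_digraph.cycle (with_proj G) c \<and> 3 \<le> length c)"

definition joins_edges :: "'a pair_pre_digraph \<Rightarrow> 'a set \<Rightarrow> 'a set \<Rightarrow> 'a list \<Rightarrow> bool" where
  "joins_edges G e f p \<longleftrightarrow>
     vpath p (with_proj G) \<and> hd p \<in> e \<and> last p \<in> f \<and> e \<notin> path_edges p \<and> f \<notin> path_edges p"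

text \<open>Well defined for distinct edges of a tree, by \<open>joins_edges_ex1\<close> below.\<close>

definition path_between :: "'a pair_pre_digraph \<Rightarrow> 'a set \<Rightarrow> 'a set \<Rightarrow> 'a list" where
  "path_between G e f = (THE p. joins_edges G e f p)"

text \<open>
  A numbering is given by its inverse \<open>\<epsilon>\<close>, which maps a number to the edge carrying it.
  Numbers are integers because the index \<open>k + 2 * s\<close> may be negative.
\<close>

definition contains_number ::
    "'a pair_pre_digraph \<Rightarrow> (int \<Rightarrow> 'a set) \<Rightarrow> 'a list \<Rightarrow> int \<Rightarrow> bool" where
  "contains_number G \<epsilon> p i \<longleftrightarrow> i \<in> {1..int (card (edges G))} \<and> \<epsilon> i \<in> path_edges p"

definition friendly_to_simple_path :: "'a pair_pre_digraph \<Rightarrow> bool" where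
  "friendly_to_simple_path G \<longleftrightarrow>
     (\<exists>\<epsilon>. bij_betw \<epsilon> {1..int (card (edges G))} (edges G) \<and>
       (\<forall>k. 1 \<le> k \<and> k < int (card (edges G)) \<longrightarrow>
         (\<forall>s.
            contains_number G \<epsilon> (path_between G (\<epsilon> k) (\<epsilon> (k + 1))) (k + 2 * s) \<longleftrightarrow>
            contains_number G \<epsilon> (path_between G (\<epsilon> k) (\<epsilon> (k + 1))) (k + 2 * s + 1))))"


lemma out_degree_eq_incident_edges:
  assumes "pair_graph G"
  shows "out_degree (with_proj G) v = card {e \<in> edges G. v \<in> e}"
proof -
  interpret pair_graph G by fact
  have "bij_betw edge_of (out_arcs (with_proj G) v) {e \<in> edges G. v \<in> e}"
  proof (rule bij_betw_imageI)
    show "inj_on edge_of (out_arcs (with_proj G) v)"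
      by (auto simp: inj_on_def edge_of_def out_arcs_def doubleton_eq_iff)
    show "edge_of ` out_arcs (with_proj G) v = {e \<in> edges G. v \<in> e}"
    proof (intro set_eqI iffI)
      fix e assume "e \<in> {e \<in> edges G. v \<in> e}"
      then obtain x y where e: "e = {x, y}" "(x, y) \<in> parcs G" "v = x \<or> v = y"
        by (auto simp: edges_def edge_of_def)
      moreover from e have "(y, x) \<in> parcs G"
        using pair_sym_arcs by (auto simp: symmetric_def sym_def)
      ultimately show "e \<in> edge_of ` out_arcs (with_proj G) v"
        by (force simp: out_arcs_def edge_of_def)
    qed (auto simp: out_arcs_def edge_of_def edges_def)
  qed
  then show ?thesis
    by (simp add: out_degree_def bij_betw_same_card)
qed

context
  fixes G :: "'a pair_pre_digraph"
  assumes tree: "undirected_tree G"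
begin

interpretation pair_graph G
  using tree by (simp add: undirected_tree_def)

private lemma sym_arc: "(x, y) \<in> parcs G \<Longrightarrow> (y, x) \<in> parcs G"
  using pair_sym_arcs by (auto simp: symmetric_def sym_def)

private lemma vwalk_Cons2:
  "vwalk (x # y # p) (with_proj G) \<longleftrightarrow> (x, y) \<in> parcs G \<and> vwalk (y # p) (with_proj G)"
  by (auto simp: vwalk_def dest: in_arcsD1)

private lemma vwalk_single: "vwalk [x] (with_proj G) \<longleftrightarrow> x \<in> pverts G"
  by (auto simp: vwalk_def)

private lemma vwalk_glue:
  "vwalk (p @ x # q) (with_proj G) \<longleftrightarrow>
     vwalk (p @ [x]) (with_proj G) \<and> vwalk (x # q) (with_proj G)"
proof (induction p)
  case Nil
  show ?case by (cases q) (auto simp: vwalk_def)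
next
  case (Cons a p)
  then show ?case by (cases p) (auto simp: vwalk_Cons2 vwalk_single)
qed

private lemma vwalk_reverse: "vwalk p (with_proj G) \<Longrightarrow> vwalk (rev p) (with_proj G)"
proof (induction p rule: vwalk_arcs.induct)
  case (3 x y p)
  then have "vwalk (rev p @ [y]) (with_proj G)" "vwalk [y, x] (with_proj G)"
    by (auto simp: vwalk_Cons2 vwalk_single sym_arc dest: in_arcsD1)
  then show ?case using vwalk_glue[of "rev p" y "[x]"] by simp
qed auto

private lemma vwalk_awalk:
  "vwalk p (with_proj G) \<Longrightarrow>
     awalk (hd p) (vwalk_arcs p) (last p) \<and> pawalk_verts (hd p) (vwalk_arcs p) = p"
proof (induction p rule: vwalk_arcs.induct)
  case (3 x y p)
  then show ?case by (auto simp: vwalk_Cons2 awalk_def dest: in_arcsD1)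
qed (auto simp: vwalk_def awalk_def)

private lemma no_closed_walk:
  assumes "vwalk (u # c @ [u]) (with_proj G)" "distinct (u # c)" "2 \<le> length c"
  shows False
proof -
  let ?c = "u # c @ [u]"
  have len: "length (vwalk_arcs ?c) = length c + 1"
    using vwalk_length_simp[of ?c] unfolding vwalk_length_def by simp
  have "awalk u (vwalk_arcs ?c) u" "pawalk_verts u (vwalk_arcs ?c) = ?c"
    using vwalk_awalk[OF assms(1)] by auto
  with assms len have "pre_digraph.cycle (with_proj G) (vwalk_arcs ?c)"
    unfolding cycle_def by (intro exI[of _ u]) auto
  with len assms(3) tree show False
    by (force simp: undirected_tree_def)
qed

lemma vpath_unique:
  assumes "vpath p (with_proj G)" "vpath q (with_proj G)" "hd p = hd q" "last p = last q"
  shows "p = q"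
  using assms
proof (induction p arbitrary: q)
  case Nil
  then show ?case by (auto simp: vpath_def vwalk_def)
next
  case (Cons u p)
  then obtain q' where q: "q = u # q'"
    by (cases q) (auto simp: vpath_def vwalk_def)
  show ?case
  proof (cases "p = [] \<or> q' = []")
    case True
    then show ?thesis using Cons.prems q
      by (auto simp: vpath_def split: if_splits)
  next
    case False
    have "vwalk p (with_proj G)" "vwalk q' (with_proj G)"
      using Cons.prems(1,2) False q by (cases p; cases q'; auto simp: vpath_def vwalk_Cons2)+
    then have vp: "vpath p (with_proj G)" "vpath q' (with_proj G)"
      using Cons.prems(1,2) q by (auto simp: vpath_def)
    have last: "last p = last q'"
      using Cons.prems(4) False q by simp
    have "hd p = hd q'"
    proof (rule ccontr)
      assume ne: "hd p \<noteq> hd q'"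
      have "\<exists>x\<in>set p. x \<in> set q'"
        using last False by (metis last_in_set)
      then obtain ps x ps' where p: "p = ps @ x # ps'" "x \<in> set q'" "\<forall>y\<in>set ps. y \<notin> set q'"
        using split_list_first_prop[of p "\<lambda>y. y \<in> set q'"] by blast
      then obtain qs qs' where q': "q' = qs @ x # qs'"
        by (meson split_list)
      have "vwalk ((u # ps) @ x # ps') (with_proj G)" "vwalk ((u # qs) @ x # qs') (with_proj G)"
        using Cons.prems(1,2) p(1) q q' by (auto simp: vpath_def)
      then have w: "vwalk ((u # ps) @ [x]) (with_proj G)" "vwalk ((u # qs) @ [x]) (with_proj G)"
        using vwalk_glue by blast+
      from vwalk_reverse[OF w(2)] have "vwalk (x # rev qs @ [u]) (with_proj G)"
        by simp
      with w(1) have "vwalk (u # (ps @ x # rev qs) @ [u]) (with_proj G)"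
        using vwalk_glue[of "u # ps" x "rev qs @ [u]"] by simp
      moreover have "distinct (u # ps @ x # rev qs)"
        using Cons.prems(1,2) p q q' by (auto simp: vpath_def)
      moreover have "2 \<le> length (ps @ x # rev qs)"
        using ne p(1) q' by (cases ps; cases qs) auto
      ultimately show False by (rule no_closed_walk)
    qed
    with Cons.IH[OF vp] last q show ?thesis by simp
  qed
qed

private lemma edge_in_walk:
  assumes "e \<in> path_edges p"
  shows "\<exists>xs x y ys. p = xs @ x # y # ys \<and> e = {x, y}"
  using assms
proof (induction p rule: vwalk_arcs.induct)
  case (3 x y p)
  show ?case
  proof (cases "e = {x, y}")
    case True
    then show ?thesis by (intro exI[of _ "[]"]) auto
  next
    case False
    with 3 obtain xs a b ys where "y # p = xs @ a # b # ys" "e = {a, b}"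
      by (auto simp: path_edges_def edge_of_def)
    then show ?thesis by (intro exI[of _ "x # xs"]) auto
  qed
qed (auto simp: path_edges_def)

private lemma edge_in_walkI: "{x, y} \<in> path_edges (xs @ x # y # ys)"
  by (induction xs rule: vwalk_arcs.induct) (auto simp: path_edges_def edge_of_def)

private lemma path_edges_rev:
  fixes p :: "'a list"
  shows "path_edges (rev p) = path_edges p"
proof -
  have "path_edges p \<subseteq> path_edges (rev p)" for p :: "'a list"
  proof
    fix e assume "e \<in> path_edges p"
    then obtain xs x y ys where "p = xs @ x # y # ys" "e = {x, y}"
      by (meson edge_in_walk)
    then show "e \<in> path_edges (rev p)"
      using edge_in_walkI[of y x "rev ys" "rev xs"] by (simp add: insert_commute)
  qed
  from this[of p] this[of "rev p"] show ?thesis by auto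
qed

private lemma joins_edges_rev: "joins_edges G e f p \<Longrightarrow> joins_edges G f e (rev p)"
  using vwalk_reverse by (auto simp: joins_edges_def path_edges_rev hd_rev last_rev vpath_def)

private lemma edge_ends:
  assumes "e \<in> edges G" "a \<in> e" "b \<in> e" "a \<noteq> b"
  shows "e = {a, b} \<and> (a, b) \<in> parcs G"
  using assms sym_arc by (auto simp: edges_def edge_of_def)

private lemma joins_avoids:
  assumes "joins_edges G e f p" "e \<in> edges G" "b \<in> e" "b \<noteq> hd p"
  shows "b \<notin> set p"
proof
  assume "b \<in> set p"
  then obtain xs ys where p: "p = xs @ b # ys"
    by (meson split_list)
  have *: "e = {hd p, b}" "(hd p, b) \<in> parcs G"
    using assms edge_ends[of e "hd p" b] by (auto simp: joins_edges_def)
  have "vpath (xs @ [b]) (with_proj G)"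
    using assms(1) p vwalk_glue[of xs b ys] by (auto simp: joins_edges_def vpath_def)
  moreover have "vpath [hd p, b] (with_proj G)"
    using * assms(4) by (auto simp: vpath_def vwalk_Cons2 vwalk_single dest: in_arcsD2)
  moreover have "hd (xs @ [b]) = hd p"
    using p by (cases xs) auto
  ultimately have "xs @ [b] = [hd p, b]"
    by (intro vpath_unique) auto
  then have "p = [] @ hd p # b # ys" using p by simp
  then have "e \<in> path_edges p"
    using edge_in_walkI * by metis
  then show False using assms(1) by (simp add: joins_edges_def)
qed

private lemma joins_avoids_last:
  assumes "joins_edges G e f p" "f \<in> edges G" "b \<in> f" "b \<noteq> last p"
  shows "b \<notin> set p"
  using joins_avoids[OF joins_edges_rev[OF assms(1)] assms(2,3)] assms(4)
  by (simp add: hd_rev)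

private lemma vpath_extend:
  assumes "vpath q (with_proj G)" "(a, hd q) \<in> parcs G" "a \<notin> set q"
  shows "vpath (a # q) (with_proj G)"
  using assms by (cases q) (auto simp: vpath_def vwalk_Cons2 vwalk_def[of "[]"])

private lemma joins_same_hd:
  assumes "joins_edges G e f p" "joins_edges G e f q" "e \<in> edges G" "f \<in> edges G" "e \<noteq> f"
  shows "hd p = hd q"
proof (rule ccontr)
  assume ne: "hd p \<noteq> hd q"
  have nonempty: "p \<noteq> []" "q \<noteq> []"
    using assms(1,2) by (auto simp: joins_edges_def vpath_def vwalk_def)
  have a: "hd p \<notin> set q" "hd q \<notin> set p"
    using joins_avoids[OF assms(2,3), of "hd p"] joins_avoids[OF assms(1,3), of "hd q"] ne assms(1,2)
    by (auto simp: joins_edges_def)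
  have e: "e = {hd p, hd q}" "(hd p, hd q) \<in> parcs G"
    using edge_ends[OF assms(3) _ _ ne] assms(1,2) by (auto simp: joins_edges_def)
  have vq: "vpath (hd p # q) (with_proj G)"
    using vpath_extend[of q "hd p"] assms(2) a e by (auto simp: joins_edges_def)
  show False
  proof (cases "last p = last q")
    case True
    then have "p = hd p # q"
      using vq assms(1) nonempty by (intro vpath_unique) (auto simp: joins_edges_def)
    with a nonempty show False by (metis hd_in_set list.set_intros(2))
  next
    case False
    have b: "last p \<notin> set q" "last q \<notin> set p"
      using joins_avoids_last[OF assms(2,4), of "last p"]
        joins_avoids_last[OF assms(1,4), of "last q"] False assms(1,2)
      by (auto simp: joins_edges_def)
    have f: "f = {last p, last q}" "(last p, last q) \<in> parcs G"
      using edge_ends[OF assms(4) _ _ False] assms(1,2) by (auto simp: joins_edges_def)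
    show False
    proof (cases "hd p = last p")
      case True
      have "hd q \<noteq> last q" using e f True assms(5) by auto
      have "vpath [hd q, hd p, last q] (with_proj G)"
        using e f ne True \<open>hd q \<noteq> last q\<close> False sym_arc
        by (auto simp: vpath_def vwalk_Cons2 vwalk_single dest: in_arcsD2)
      then have "q = [hd q, hd p, last q]"
        using assms(2) by (intro vpath_unique) (auto simp: joins_edges_def)
      with a show False by (metis list.set_intros(1,2))
    next
      case neq: False
      have "vpath (rev (hd p # q)) (with_proj G)"
        using vq vwalk_reverse[of "hd p # q"] by (auto simp: vpath_def)
      then have "vpath (last p # rev (hd p # q)) (with_proj G)"
        by (rule vpath_extend) (use nonempty f b neq in \<open>auto simp: hd_rev\<close>)
      moreover have "vpath (rev p) (with_proj G)"
        using assms(1) vwalk_reverse[of p] by (auto simp: joins_edges_def vpath_def)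
      ultimately have "rev p = last p # rev (hd p # q)"
        using nonempty by (intro vpath_unique) (auto simp: hd_rev last_rev)
      then have "set q \<subseteq> set p"
        by (metis set_rev set_subset_Cons subset_trans)
      with a nonempty show False by (meson hd_in_set subsetD)
    qed
  qed
qed

private lemma connected_vwalk:
  assumes "u \<in> pverts G" "v \<in> pverts G"
  shows "\<exists>p. vwalk p (with_proj G) \<and> hd p = u \<and> last p = v"
proof -
  have "mk_symmetric (with_proj G) = G"
  proof -
    have "(\<Union>e\<in>parcs G. {(fst e, snd e), (snd e, fst e)}) = parcs G"
      using sym_arc by auto
    then show ?thesis by (simp add: mk_symmetric_def)
  qed
  with tree assms have "u \<rightarrow>\<^sup>*\<^bsub>with_proj G\<^esub> v"
    by (auto simp: undirected_tree_def connected_def strongly_connected_def)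
  then show ?thesis
    by (simp add: reachable_vwalk_conv)
qed

lemma joins_edges_ex1:
  assumes "e \<in> edges G" "f \<in> edges G" "e \<noteq> f"
  shows "\<exists>!p. joins_edges G e f p"
proof (rule ex_ex1I)
  define W where
    "W = (\<lambda>n. \<exists>p. vwalk p (with_proj G) \<and> hd p \<in> e \<and> last p \<in> f \<and> length p = n)"
  have vert: "\<exists>u \<in> pverts G. u \<in> e" if "e \<in> edges G" for e
    using that by (fastforce simp: edges_def edge_of_def dest: in_arcsD1)
  obtain u v where "u \<in> e" "u \<in> pverts G" "v \<in> f" "v \<in> pverts G"
    using vert[OF assms(1)] vert[OF assms(2)] by blast
  then have "\<exists>n. W n"
    unfolding W_def using connected_vwalk[of u v] by blast
  then have "W (LEAST n. W n)" by (rule LeastI_ex)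
  then obtain p where p: "vwalk p (with_proj G)" "hd p \<in> e" "last p \<in> f"
    and len: "length p = (LEAST n. W n)"
    by (auto simp: W_def)
  have least: "length p \<le> length q"
    if "vwalk q (with_proj G)" "hd q \<in> e" "last q \<in> f" for q
    unfolding len by (rule Least_le) (use that in \<open>auto simp: W_def\<close>)
  have "e \<notin> path_edges p"
  proof
    assume "e \<in> path_edges p"
    then obtain xs x y ys where *: "p = xs @ x # y # ys" "e = {x, y}"
      by (meson edge_in_walk)
    with p have "vwalk (y # ys) (with_proj G)"
      using vwalk_glue[of "xs @ [x]" y ys] by simp
    then show False using least[of "y # ys"] * p by auto
  qed
  moreover have "f \<notin> path_edges p"
  proof
    assume "f \<in> path_edges p"
    then obtain xs x y ys where *: "p = xs @ x # y # ys" "f = {x, y}"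
      by (meson edge_in_walk)
    with p have "vwalk (xs @ [x]) (with_proj G)"
      using vwalk_glue[of xs x "y # ys"] by simp
    moreover have "hd (xs @ [x]) = hd p" using * by (cases xs) auto
    ultimately show False using least[of "xs @ [x]"] * p by auto
  qed
  moreover have "distinct p"
  proof (rule ccontr)
    assume "\<not> distinct p"
    then obtain xs ys zs x where *: "p = xs @ [x] @ ys @ [x] @ zs"
      by (meson not_distinct_decomp)
    with p(1) have "vwalk (xs @ x # zs) (with_proj G)"
      using vwalk_glue[of xs x "ys @ x # zs"] vwalk_glue[of "xs @ x # ys" x zs]
        vwalk_glue[of xs x zs] by simp
    moreover have "hd (xs @ x # zs) = hd p" using * by (cases xs) auto
    moreover have "last (xs @ x # zs) = last p" using * by simp
    ultimately show False using least[of "xs @ x # zs"] p * by auto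
  qed
  ultimately have "joins_edges G e f p"
    using p by (simp add: joins_edges_def vpath_def)
  then show "\<exists>p. joins_edges G e f p" ..
next
  fix p q assume pq: "joins_edges G e f p" "joins_edges G e f q"
  have "hd p = hd q"
    using joins_same_hd[OF pq assms] .
  moreover have "hd (rev p) = hd (rev q)"
    using joins_same_hd[OF joins_edges_rev[OF pq(1)] joins_edges_rev[OF pq(2)]] assms by simp
  ultimately show "p = q"
    using pq by (intro vpath_unique) (auto simp: joins_edges_def hd_rev)
qed

end

end

theory Submission
  imports Defs
begin

text \<open>
  The numbering builds the tree edge by edge: edge \<open>k\<close> joins a vertex \<open>u\<^sub>k\<close> that is already
  present to a new vertex \<open>w\<^sub>k\<close>.  The path from edge \<open>k\<close> to edge \<open>k + 1\<close> is then empty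
  (\<open>u\<^sub>k\<^sub>+\<^sub>1 = w\<^sub>k\<close>) or runs from \<open>u\<^sub>k\<close> to \<open>u\<^sub>k\<^sub>+\<^sub>1\<close>, and its numbers form the symmetric
  difference of the sets \<open>anc u\<^sub>k\<close> and \<open>anc u\<^sub>k\<^sub>+\<^sub>1\<close> of the numbers between these vertices and
  the root.  The claim says that this difference is a union of pairs \<open>{i, i + 1}\<close> with
  \<open>i \<equiv> k\<close> modulo 2; for fixed parity of \<open>k\<close> this is an equivalence relation between vertices.

  The tree consists of the given path (the spine) and of legs, that is, paths hanging off spine
  vertices.  The spine is traversed from its first vertex.  At a spine vertex \<open>v\<close> with
  successor \<open>v'\<close>, the legs with an odd number of edges are numbered first, each from \<open>v\<close>
  outwards; then come the edge \<open>vv'\<close>, the first edges of all even legs, and finally the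
  remainders of the even legs in the reverse order, each outwards.  A path out of an odd leg or
  out of such a remainder crosses an even number of its edges, which pair up; a path from one
  even leg to the preceding one, or from the first one to \<open>v'\<close>, crosses in addition two
  consecutively numbered edges at \<open>v\<close>.
\<close>

section \<open>Parity-paired differences and builds that grow leaf by leaf\<close>

text \<open>Only the parity of \<open>c\<close> enters, so lengths of arc lists can be exchanged
  modulo 2.\<close>

definition sim :: "int \<Rightarrow> (int \<Rightarrow> bool) \<Rightarrow> (int \<Rightarrow> bool) \<Rightarrow> bool" where
  "sim c X Y \<longleftrightarrow> (\<forall>i. even (i - c) \<longrightarrow> (X i \<noteq> Y i \<longleftrightarrow> X (i + 1) \<noteq> Y (i + 1)))"

lemma sim_refl: "sim c X X"
  by (simp add: sim_def)

lemma sim_trans: "sim c X Y \<Longrightarrow> sim c Y Z \<Longrightarrow> sim c X Z"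
  unfolding sim_def by (metis (full_types))

text \<open>
  The list of arcs is kept with the newest arc first, so that the arc at the head of a list
  of length \<open>k\<close> has number \<open>k\<close>.
\<close>

fun anc :: "('a \<times> 'a) list \<Rightarrow> 'a \<Rightarrow> int \<Rightarrow> bool" where
  "anc [] x i \<longleftrightarrow> False"
| "anc ((u, w) # es) x i \<longleftrightarrow>
     (if x = w then anc es u i \<noteq> (i = int (length es) + 1) else anc es x i)"

lemma anc_range: "anc es x i \<Longrightarrow> 1 \<le> i \<and> i \<le> int (length es)"
  by (induction es x i rule: anc.induct) (auto split: if_splits)

text \<open>The next arc of the numbering may start at \<open>x\<close>.\<close>

fun jump :: "('a \<times> 'a) list \<Rightarrow> 'a \<Rightarrow> bool" where
  "jump [] x \<longleftrightarrow> True"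
| "jump ((u, w) # es) x \<longleftrightarrow>
     x = w \<or> sim (int (length es) + 1) (anc ((u, w) # es) u) (anc ((u, w) # es) x)"

context
  fixes P :: "'a rel" and r :: 'a
begin

definition built :: "('a \<times> 'a) list \<Rightarrow> 'a set" where
  "built es = insert r (snd ` set es)"

text \<open>As \<open>w\<close> is new, each arc attaches a leaf, and a build is a tree rooted at
  \<open>r\<close>. The condition \<open>jump\<close> relates the new arc to the one at the head of
  \<open>es\<close>.\<close>

fun friendly_build :: "('a \<times> 'a) list \<Rightarrow> bool" where
  "friendly_build [] \<longleftrightarrow> True"
| "friendly_build ((u, w) # es) \<longleftrightarrow>
     friendly_build es \<and> (u, w) \<in> P \<and> u \<in> built es \<and> w \<notin> built es \<and> jump es u"

lemma built_simps [simp]: "built [] = {r}" "built ((u, w) # es) = insert w (built es)"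
  by (auto simp: built_def)

lemma built_append: "built (fs @ es) = built es \<union> snd ` set fs"
  by (auto simp: built_def)

lemma friendly_build_suffix: "friendly_build (fs @ es) \<Longrightarrow> friendly_build es"
  by (induction fs) auto

text \<open>Later arcs only attach leaves, so the way from an old vertex to the root never
  changes.\<close>

lemma anc_suffix: "friendly_build (fs @ es) \<Longrightarrow> x \<in> built es \<Longrightarrow> anc (fs @ es) x = anc es x"
  by (induction fs) (auto simp: built_append fun_eq_iff split: if_splits)

section \<open>Numbering the legs at one vertex\<close>

text \<open>The list holds the vertices after \<open>v\<close>, so its length is the number of edges
  of the leg.\<close>

definition leg :: "'a \<Rightarrow> 'a list \<Rightarrow> bool" where
  "leg v xs \<longleftrightarrow> xs \<noteq> [] \<and> distinct xs \<and> successively (\<lambda>a b. (a, b) \<in> P) (v # xs)"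

text \<open>Between \<open>v\<close> and the start \<open>fst (hd fs)\<close> of the last arc lie
  all other arcs of the leg: evenly many, numbered consecutively, hence paired up with the right
  parity. The conclusion is a \<open>sim\<close> and not a \<open>jump\<close> so that
  \<open>even_legs\<close> can chain it to a vertex other than \<open>v\<close>.\<close>

lemma odd_leg:
  assumes "friendly_build es" "v \<in> built es" "jump es v"
    and "leg v xs" "odd (length xs)" "set xs \<inter> built es = {}"
  shows "\<exists>fs. friendly_build (fs @ es) \<and> built (fs @ es) = built es \<union> set xs \<and>
    length fs = length xs \<and>
    sim (int (length (fs @ es))) (anc (fs @ es) (fst (hd fs))) (anc es v)"
  using assms
proof (induction xs arbitrary: es v rule: induct_list012)
  case (2 x)
  have "x \<noteq> v" using 2 by auto
  then have "anc ((v, x) # es) v = anc es v" by (auto simp: fun_eq_iff)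
  with 2 show ?case
    by (intro exI[of _ "[(v, x)]"]) (auto simp: leg_def sim_refl)
next
  case (3 x y xs)
  let ?es = "(x, y) # (v, x) # es"
  have ne: "x \<noteq> v" "y \<noteq> v" "x \<noteq> y" using 3 by (auto simp: leg_def)
  have good: "friendly_build ?es" using 3 ne by (auto simp: leg_def)
  have "\<exists>fs. friendly_build (fs @ ?es) \<and> built (fs @ ?es) = built ?es \<union> set xs \<and>
    length fs = length xs \<and>
    sim (int (length (fs @ ?es))) (anc (fs @ ?es) (fst (hd fs))) (anc ?es y)"
  proof (rule "3.IH"(1)[OF good])
    show "leg y xs" using "3.prems" by (cases xs) (auto simp: leg_def)
  qed (use "3.prems" in \<open>auto simp: leg_def\<close>)
  then obtain fs where fs: "friendly_build (fs @ ?es)" "built (fs @ ?es) = built ?es \<union> set xs"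
    "length fs = length xs"
    "sim (int (length (fs @ ?es))) (anc (fs @ ?es) (fst (hd fs))) (anc ?es y)"
    by blast
  \<comment> \<open>The two predicates differ only at \<open>length es + 1\<close> and
    \<open>length es + 2\<close>; the former has the parity of the total length because
    \<open>length xs\<close> is odd.\<close>
  have "sim (int (length (fs @ ?es))) (anc ?es y) (anc es v)"
    using "3.prems"(5) fs(3) ne by (auto simp: sim_def)
  with fs have "sim (int (length (fs @ ?es))) (anc (fs @ ?es) (fst (hd fs))) (anc es v)"
    using sim_trans by blast
  moreover have "fs \<noteq> []" using fs(3) "3.prems"(5) by auto
  ultimately show ?case using fs
    by (intro exI[of _ "fs @ [(x, y), (v, x)]"]) (auto simp: hd_append)
qed auto

lemma sim_jump:
  assumes "fs \<noteq> []" "sim (int (length (fs @ es))) (anc (fs @ es) (fst (hd fs))) (anc (fs @ es) v)"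
  shows "jump (fs @ es) v"
  using assms by (cases fs) (auto simp: add.commute)

definition legs :: "'a set \<Rightarrow> 'a \<Rightarrow> 'a list set \<Rightarrow> bool" where
  "legs V v F \<longleftrightarrow> finite F \<and> (\<forall>xs\<in>F. leg v xs \<and> set xs \<inter> V = {}) \<and>
     (\<forall>xs\<in>F. \<forall>ys\<in>F. xs \<noteq> ys \<longrightarrow> set xs \<inter> set ys = {})"

text \<open>Carries the leg hypotheses along a growing build: \<open>W\<close> accounts for newly
  built vertices, \<open>F'\<close> for the legs considered next.\<close>

lemma legs_subset:
  assumes "legs V v F" "F' \<subseteq> F" "V' \<subseteq> V \<union> W" "\<And>xs. xs \<in> F' \<Longrightarrow> set xs \<inter> W = {}"
  shows "legs V' v F'"
  unfolding legs_def
proof (intro conjI ballI impI)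
  show "finite F'" using assms(1,2) finite_subset by (auto simp: legs_def)
next
  fix xs assume xs: "xs \<in> F'"
  then have "leg v xs" "set xs \<inter> V = {}" using assms(1,2) by (auto simp: legs_def)
  then show "leg v xs" "set xs \<inter> V' = {}" using assms(3) assms(4)[OF xs] by auto
next
  fix xs ys assume "xs \<in> F'" "ys \<in> F'" "xs \<noteq> ys"
  then show "set xs \<inter> set ys = {}" using assms(1,2) unfolding legs_def by (meson subsetD)
qed

lemma legs_disjoint:
  "legs V v F \<Longrightarrow> xs \<in> F \<Longrightarrow> ys \<in> F \<Longrightarrow> x \<in> set xs \<Longrightarrow> x \<in> set ys \<Longrightarrow> xs = ys"
  unfolding legs_def by blast

lemma legs_insert:
  assumes "legs V v (insert xs F)" "xs \<notin> F"
  shows "leg v xs" "set xs \<inter> V = {}" "\<And>ys. ys \<in> F \<Longrightarrow> set ys \<inter> set xs = {}"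
  using assms by (fastforce simp: legs_def)+

text \<open>After an odd leg the next arc may start at \<open>v\<close> again, so the legs can be
  taken one by one in any order.\<close>

lemma odd_legs:
  assumes "friendly_build es" "v \<in> built es" "jump es v"
    and "legs (built es) v F" "\<And>xs. xs \<in> F \<Longrightarrow> odd (length xs)"
  shows "\<exists>fs. friendly_build (fs @ es) \<and> built (fs @ es) = built es \<union> \<Union>(set ` F) \<and> jump (fs @ es) v"
proof -
  have "finite F" using assms by (simp add: legs_def)
  then show ?thesis using assms
  proof (induction F arbitrary: es rule: finite_induct)
    case empty
    then show ?case by (intro exI[of _ "[]"]) auto
  next
    case (insert xs F)
    have xs: "leg v xs" "odd (length xs)" "set xs \<inter> built es = {}"
      using legs_insert[OF insert.prems(4) insert.hyps(2)] insert.prems(5) by auto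
    from odd_leg[OF insert.prems(1-3) this] obtain fs
      where fs: "friendly_build (fs @ es)" "built (fs @ es) = built es \<union> set xs"
        "length fs = length xs"
        "sim (int (length (fs @ es))) (anc (fs @ es) (fst (hd fs))) (anc es v)"
      by blast
    have "jump (fs @ es) v"
      using fs xs(2) anc_suffix[OF fs(1) insert.prems(2)] by (intro sim_jump) auto
    moreover have "legs (built (fs @ es)) v F"
      by (rule legs_subset[OF insert.prems(4), of _ _ "set xs"])
        (use legs_insert[OF insert.prems(4) insert.hyps(2)] fs(2) in auto)
    ultimately have "\<exists>gs. friendly_build (gs @ fs @ es) \<and>
        built (gs @ fs @ es) = built (fs @ es) \<union> \<Union>(set ` F) \<and> jump (gs @ fs @ es) v"
      using insert.prems fs by - (rule insert.IH[OF fs(1)], auto)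
    then obtain gs where "friendly_build (gs @ fs @ es)"
        "built (gs @ fs @ es) = built (fs @ es) \<union> \<Union>(set ` F)" "jump (gs @ fs @ es) v"
      by blast
    then show ?case using fs(2) by (intro exI[of _ "gs @ fs"]) auto
  qed
qed

text \<open>The induction nests the legs: first arc of \<open>zs\<close>, then all legs in
  \<open>F\<close>, then the rest of \<open>zs\<close>; this reverses the order of the remainders.
  The last conjunct drives it: applied to the newest arc \<open>(v, x)\<close>, it allows the return
  to \<open>x\<close>, where the rest of \<open>zs\<close> begins.\<close>

lemma even_legs:
  assumes "friendly_build es" "v \<in> built es" "jump es v"
    and "legs (built es) v F" "\<And>xs. xs \<in> F \<Longrightarrow> even (length xs)"
  shows "\<exists>fs. friendly_build (fs @ es) \<and> built (fs @ es) = built es \<union> \<Union>(set ` F) \<and>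
    even (length fs) \<and> (\<forall>y es'. es = (v, y) # es' \<longrightarrow> jump (fs @ es) y)"
proof -
  have "finite F" using assms by (simp add: legs_def)
  then show ?thesis using assms
  proof (induction F arbitrary: es rule: finite_induct)
    case empty
    then show ?case by (intro exI[of _ "[]"]) auto
  next
    case (insert zs F)
    note legs = legs_insert[OF insert.prems(4) insert.hyps(2)]
    have zs: "leg v zs" "even (length zs)" "set zs \<inter> built es = {}"
      using legs insert.prems(5) by auto
    obtain x xs where x: "zs = x # xs" using zs(1) by (cases zs) (auto simp: leg_def)
    have ne: "x \<noteq> v" using x zs insert.prems(2) by auto
    let ?es = "(v, x) # es"
    have good: "friendly_build ?es" using insert.prems x zs by (auto simp: leg_def)
    have "legs (built ?es) v F"
      by (rule legs_subset[OF insert.prems(4), of _ _ "{x}"]) (use legs(3) x in auto)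
    \<comment> \<open>Here \<open>jump ?es v\<close> holds by reflexivity, as the newest arc starts
      at \<open>v\<close>.\<close>
    then have "\<exists>gs. friendly_build (gs @ ?es) \<and> built (gs @ ?es) = built ?es \<union> \<Union>(set ` F) \<and>
      even (length gs) \<and> (\<forall>y es'. ?es = (v, y) # es' \<longrightarrow> jump (gs @ ?es) y)"
      using insert.prems by - (rule insert.IH[OF good], auto simp: sim_refl)
    then obtain gs where gs: "friendly_build (gs @ ?es)"
      "built (gs @ ?es) = built ?es \<union> \<Union>(set ` F)" "even (length gs)" "jump (gs @ ?es) x"
      by blast
    have xs: "leg x xs" "odd (length xs)" "set xs \<inter> built (gs @ ?es) = {}"
    proof -
      show "odd (length xs)" using zs(2) x by simp
      then show "leg x xs" using zs(1) x by (cases xs) (auto simp: leg_def)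
      show "set xs \<inter> built (gs @ ?es) = {}"
        using legs(3) x gs(2) zs by (fastforce simp: leg_def)
    qed
    have xin: "x \<in> built (gs @ ?es)" using gs(2) by simp
    from odd_leg[OF gs(1) xin gs(4) xs] obtain fs
      where fs: "friendly_build (fs @ gs @ ?es)"
        "built (fs @ gs @ ?es) = built (gs @ ?es) \<union> set xs" "length fs = length xs"
        "sim (int (length (fs @ gs @ ?es))) (anc (fs @ gs @ ?es) (fst (hd fs))) (anc (gs @ ?es) x)"
      by blast
    have "jump (fs @ gs @ ?es) y" if es: "es = (v, y) # es'" for y es'
    proof (rule sim_jump)
      show "fs \<noteq> []" using fs(3) xs(2) by auto
      have ny: "y \<noteq> v" "x \<noteq> y" using es insert.prems(1) good by auto
      have "anc (gs @ ?es) x = anc ?es x" using gs(1) by (intro anc_suffix) auto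
      moreover have "anc ((fs @ gs) @ ?es) y = anc ?es y"
        using fs(1) es by (intro anc_suffix) auto
      \<comment> \<open>The arcs from \<open>v\<close> to \<open>y\<close> and to \<open>x\<close>
        have the consecutive numbers \<open>length es\<close> and \<open>length es + 1\<close>. The
        total length has the parity of \<open>length es\<close>, since \<open>fs\<close> is odd,
        \<open>gs\<close> is even and \<open>(v, x)\<close> adds one.\<close>
      moreover have "sim (int (length (fs @ gs @ ?es))) (anc ?es x) (anc ?es y)"
        using es ny fs(3) xs(2) gs(3) by (auto simp: sim_def)
      ultimately show "sim (int (length (fs @ gs @ ?es)))
        (anc (fs @ gs @ ?es) (fst (hd fs))) (anc (fs @ gs @ ?es) y)"
        using fs(4) by (auto intro: sim_trans)
    qed
    moreover have "built (fs @ gs @ ?es) = built es \<union> \<Union>(set ` insert zs F)"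
      using fs(2) gs(2) x by auto
    moreover have "even (length (fs @ gs @ [(v, x)]))"
      using fs(3) gs(3) xs(2) by simp
    ultimately show ?case using fs(1)
      by (intro exI[of _ "fs @ gs @ [(v, x)]"]) auto
  qed
qed

section \<open>Traversing the spine\<close>

text \<open>At each spine vertex \<open>odd_legs\<close> ends with a jump to \<open>v\<close> and
  \<open>even_legs\<close> with one to the next spine vertex, which restores the hypotheses
  there.\<close>

lemma spine_with_legs:
  assumes "friendly_build es" "v \<in> built es" "jump es v"
    and "successively (\<lambda>a b. (a, b) \<in> P) (v # vs)" "distinct vs" "set vs \<inter> built es = {}"
    and "\<And>x. x \<in> set (v # vs) \<Longrightarrow> legs (built es \<union> set vs) x (L x)"
    and "\<And>x y xs ys. x \<in> set (v # vs) \<Longrightarrow> y \<in> set (v # vs) \<Longrightarrow> x \<noteq> y \<Longrightarrow>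
      xs \<in> L x \<Longrightarrow> ys \<in> L y \<Longrightarrow> set xs \<inter> set ys = {}"
  shows "\<exists>fs. friendly_build fs \<and>
    built fs = built es \<union> set vs \<union> (\<Union>x\<in>set (v # vs). \<Union>(set ` L x))"
  using assms
proof (induction vs arbitrary: v es)
  case (Nil v es)
  let ?O = "{xs \<in> L v. odd (length xs)}" and ?E = "{xs \<in> L v. even (length xs)}"
  have L: "legs (built es) v (L v)" using Nil.prems(7)[of v] by simp
  have "legs (built es) v ?O" by (rule legs_subset[OF L, of _ _ "{}"]) auto
  from odd_legs[OF Nil.prems(1-3) this] obtain gs where gs: "friendly_build (gs @ es)"
    "built (gs @ es) = built es \<union> \<Union>(set ` ?O)" "jump (gs @ es) v" by auto
  have v: "v \<in> built (gs @ es)" using gs(2) Nil.prems(2) by simp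
  have "legs (built (gs @ es)) v ?E"
    by (rule legs_subset[OF L, of _ _ "\<Union>(set ` ?O)"]) (use L gs(2) in \<open>auto dest: legs_disjoint\<close>)
  from even_legs[OF gs(1) v gs(3) this] obtain fs where
    "friendly_build (fs @ gs @ es)" "built (fs @ gs @ es) = built (gs @ es) \<union> \<Union>(set ` ?E)"
    by auto
  with gs(2) show ?case by (intro exI[of _ "fs @ gs @ es"]) auto
next
  case (Cons v' vs v es)
  let ?O = "{xs \<in> L v. odd (length xs)}" and ?E = "{xs \<in> L v. even (length xs)}"
  have L: "legs (built es \<union> set (v' # vs)) v (L v)" by (rule Cons.prems(7)) simp
  have avoid: "set xs \<inter> (built es \<union> set (v' # vs)) = {}" if "xs \<in> L v" for xs
    using L that by (simp add: legs_def)
  have "legs (built es) v ?O" by (rule legs_subset[OF L, of _ _ "{}"]) auto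
  from odd_legs[OF Cons.prems(1-3) this] obtain gs where gs: "friendly_build (gs @ es)"
    "built (gs @ es) = built es \<union> \<Union>(set ` ?O)" "jump (gs @ es) v" by auto
  \<comment> \<open>Placed between odd and even legs, the spine edge takes the role of the newest
    arc \<open>(v, y)\<close> in \<open>even_legs\<close>.\<close>
  let ?es = "(v, v') # gs @ es"
  have "v' \<notin> built (gs @ es)" using gs(2) avoid Cons.prems(6) by auto
  moreover have "v \<in> built (gs @ es)" using gs(2) Cons.prems(2) by simp
  ultimately have es: "friendly_build ?es" "v \<in> built ?es" "jump ?es v"
    using gs(1,3) Cons.prems(4) by (simp_all add: sim_refl)
  have "legs (built ?es) v ?E"
    by (rule legs_subset[OF L, of _ _ "\<Union>(set ` ?O)"]) (use L gs(2) in \<open>auto dest: legs_disjoint\<close>)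
  from even_legs[OF es this] obtain fs where
    fs: "friendly_build (fs @ ?es)" "built (fs @ ?es) = built ?es \<union> \<Union>(set ` ?E)"
    "jump (fs @ ?es) v'"
    by auto
  have built: "built (fs @ ?es) = built es \<union> {v'} \<union> \<Union>(set ` L v)"
    unfolding fs(2) using gs(2) by auto
  have "\<exists>hs. friendly_build hs \<and>
    built hs = built (fs @ ?es) \<union> set vs \<union> (\<Union>x\<in>set (v' # vs). \<Union>(set ` L x))"
  proof (rule Cons.IH[OF fs(1) _ fs(3)])
    show "v' \<in> built (fs @ ?es)" "successively (\<lambda>a b. (a, b) \<in> P) (v' # vs)" "distinct vs"
      using Cons.prems(4,5) built by auto
    show "set vs \<inter> built (fs @ ?es) = {}"
      unfolding built using Cons.prems(5,6) avoid by fastforce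
    show "set xs \<inter> set ys = {}" if "x \<in> set (v' # vs)" "y \<in> set (v' # vs)" "x \<noteq> y"
      "xs \<in> L x" "ys \<in> L y" for x y xs ys
      by (rule Cons.prems(8)[OF _ _ that(3-5)]) (use that(1,2) in auto)
    show "legs (built (fs @ ?es) \<union> set vs) x (L x)" if x: "x \<in> set (v' # vs)" for x
    proof (rule legs_subset)
      show "legs (built es \<union> set (v' # vs)) x (L x)" by (rule Cons.prems(7)) (use x in simp)
      show "built (fs @ ?es) \<union> set vs \<subseteq> built es \<union> set (v' # vs) \<union> \<Union>(set ` L v)"
        unfolding built by auto
      have "x \<noteq> v" using x Cons.prems(2,6) by auto
      then show "set xs \<inter> \<Union>(set ` L v) = {}" if "xs \<in> L x" for xs
        using Cons.prems(8)[of x v xs] x that by auto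
    qed simp
  qed
  then show ?case unfolding built by (auto simp: Un_ac)
qed

end

section \<open>From a friendly build to a numbering of the edges\<close>

text \<open>With the newest arc first, arc \<open>k\<close> is followed in the list by exactly the
  \<open>k - 1\<close> older arcs.\<close>

lemma list_split_at:
  assumes "1 \<le> k" "k \<le> int (length es)"
  obtains fs u w es' where "es = fs @ (u, w) # es'" "k = int (length es') + 1"
proof -
  let ?m = "length es - nat k"
  have m: "?m < length es" using assms by linarith
  then have "es = take ?m es @ es ! ?m # drop (Suc ?m) es" by (rule id_take_nth_drop)
  moreover have "k = int (length (drop (Suc ?m) es)) + 1" using assms by simp
  ultimately show thesis using that by (metis surj_pair)
qed

definition numbering :: "('a \<times> 'a) list \<Rightarrow> int \<Rightarrow> 'a set" where
  "numbering es k = edge_of (rev es ! nat (k - 1))"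

lemma numbering_append:
  "numbering (fs @ (u, w) # es) (int (length es) + 1) = {u, w}"
  by (simp add: numbering_def edge_of_def nth_append)

lemma numbering_image: "numbering es ` {1..int (length es)} = edge_of ` set es"
proof -
  have "numbering es ` {1..int (length es)} = (\<lambda>j. edge_of (rev es ! j)) ` {..<length es}"
  proof -
    have "{..<length es} = (\<lambda>k. nat (k - 1)) ` {1..int (length es)}"
    proof (intro equalityI subsetI)
      fix j assume "j \<in> {..<length es}"
      then show "j \<in> (\<lambda>k. nat (k - 1)) ` {1..int (length es)}"
        by (intro image_eqI[of _ _ "int j + 1"]) auto
    qed auto
    then show ?thesis by (simp add: numbering_def image_image)
  qed
  also have "\<dots> = edge_of ` set (rev es)"
    by (auto simp: set_conv_nth)
  finally show ?thesis by simp
qed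

text \<open>When arc \<open>k\<close> is added, its new end gets the predicate of its old end with
  \<open>k\<close> toggled; \<open>anc_suffix\<close> preserves this.\<close>

lemma anc_edge:
  assumes "friendly_build P r es" "1 \<le> k" "k \<le> int (length es)" "numbering es k = {x, y}"
  shows "anc es x i \<noteq> anc es y i \<longleftrightarrow> i = k"
proof -
  obtain fs u w es' where es: "es = fs @ (u, w) # es'" "k = int (length es') + 1"
    using list_split_at assms(2,3) by blast
  have good: "friendly_build P r ((u, w) # es')"
    using assms(1) unfolding es(1) by (rule friendly_build_suffix)
  then have "anc es u = anc ((u, w) # es') u" "anc es w = anc ((u, w) # es') w"
    using anc_suffix[of P r fs "(u, w) # es'"] assms(1) es(1) by auto
  moreover have "u \<noteq> w" using good by auto
  ultimately have "anc es u i \<noteq> anc es w i \<longleftrightarrow> i = k" using es(2) by auto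
  moreover have "{u, w} = {x, y}" using assms(4) es numbering_append by metis
  ultimately show ?thesis by (auto simp: doubleton_eq_iff)
qed

text \<open>An edge determines its number as the only place where the \<open>anc\<close> predicates
  of its ends differ.\<close>

lemma inj_on_numbering:
  assumes "friendly_build P r es"
  shows "inj_on (numbering es) {1..int (length es)}"
proof (rule inj_onI)
  fix i j assume *: "i \<in> {1..int (length es)}" "j \<in> {1..int (length es)}"
    "numbering es i = numbering es j"
  then obtain fs u w es' where "es = fs @ (u, w) # es'" "i = int (length es') + 1"
    using list_split_at by (metis atLeastAtMost_iff)
  then have "numbering es i = {u, w}" using numbering_append by metis
  with * show "i = j"
    using anc_edge[OF assms, of i u w i] anc_edge[OF assms, of j u w i] by auto
qed

text \<open>Each new vertex is a leaf of the build, so it can prolong a path at either end.\<close>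

lemma build_vpath:
  assumes "friendly_build (parcs G) r es" "pair_graph G" "r \<in> pverts G"
    and "a \<in> built r es" "b \<in> built r es"
  shows "\<exists>p. vpath p (with_proj G) \<and> hd p = a \<and> last p = b \<and> set p \<subseteq> built r es \<and>
    path_edges p \<subseteq> edge_of ` set es"
  using assms
proof (induction es arbitrary: a b)
  case Nil
  then show ?case by (intro exI[of _ "[r]"]) (auto simp: vpath_def vwalk_def path_edges_def)
next
  case (Cons e es)
  obtain u w where e: "e = (u, w)" by (cases e)
  interpret pair_graph G by fact
  have new: "(u, w) \<in> parcs G" "(w, u) \<in> parcs G" "w \<notin> built r es" "u \<in> built r es"
    using Cons.prems(1) e pair_sym_arcs by (auto simp: symmetric_def sym_def)
  have IH: "\<exists>p. vpath p (with_proj G) \<and> hd p = a \<and> last p = b \<and> set p \<subseteq> built r es \<and>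
    path_edges p \<subseteq> edge_of ` set es" if "a \<in> built r es" "b \<in> built r es" for a b
    using Cons.IH[of a b] Cons.prems(1-3) e that by auto
  consider "a \<in> built r es" "b \<in> built r es" | "a = w" "b \<in> built r es"
    | "a \<in> built r es" "b = w" | "a = w" "b = w"
    using Cons.prems(4,5) e by auto
  then show ?case
  proof cases
    case 1
    from IH[OF this] show ?thesis using e by fastforce
  next
    case 2
    obtain p where p: "vpath p (with_proj G)" "hd p = u" "last p = b" "set p \<subseteq> built r es"
      "path_edges p \<subseteq> edge_of ` set es"
      using IH[OF new(4) 2(2)] by blast
    then obtain p' where "p = u # p'" by (cases p) (auto simp: vpath_def vwalk_def)
    with p new 2 e show ?thesis
      by (intro exI[of _ "w # p"])
        (auto simp: vpath_def vwalk_def path_edges_def edge_of_def dest: in_arcsD2)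
  next
    case 3
    obtain p where p: "vpath p (with_proj G)" "hd p = a" "last p = u" "set p \<subseteq> built r es"
      "path_edges p \<subseteq> edge_of ` set es"
      using IH[OF 3(1) new(4)] by blast
    then have "p \<noteq> []" by (auto simp: vpath_def vwalk_def)
    with p new 3 e show ?thesis
      by (intro exI[of _ "p @ [w]"])
        (auto simp: vpath_def vwalk_def path_edges_def edge_of_def set_vwalk_arcs_snoc
          dest: in_arcsD2)
  next
    case 4
    with new e show ?thesis
      by (intro exI[of _ "[w]"]) (auto simp: vpath_def vwalk_def path_edges_def dest: in_arcsD2)
  qed
qed

lemma friendly_build_subset: "friendly_build P r es \<Longrightarrow> set es \<subseteq> P"
  by (induction es) auto

text \<open>An edge outside the build would be a second path between its ends, next to the one from
  \<open>build_vpath\<close>; paths in a tree are unique.\<close>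

lemma edges_build:
  assumes tree: "undirected_tree G" and build: "friendly_build (parcs G) r es"
    and "built r es = pverts G"
  shows "edges G = edge_of ` set es"
proof
  interpret pair_graph G using tree by (simp add: undirected_tree_def)
  have r: "r \<in> pverts G" using assms(3) by (auto simp: built_def)
  show "edges G \<subseteq> edge_of ` set es"
  proof
    fix e assume "e \<in> edges G"
    then obtain a b where e: "e = edge_of (a, b)" "(a, b) \<in> parcs G"
      by (auto simp: edges_def)
    have ab: "a \<in> pverts G" "b \<in> pverts G" "a \<noteq> b"
      using e(2) in_arcsD1 in_arcsD2 no_loops by fastforce+
    obtain p where p: "vpath p (with_proj G)" "hd p = a" "last p = b"
      "path_edges p \<subseteq> edge_of ` set es"
      using build_vpath[OF build _ r, of a b] ab assms(3) pair_graph_axioms by auto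
    have "vpath [a, b] (with_proj G)" using e(2) ab by (auto simp: vpath_def vwalk_def)
    then have "p = [a, b]" using p by (intro vpath_unique[OF tree]) auto
    with p(4) e(1) show "e \<in> edge_of ` set es" by (simp add: path_edges_def)
  qed
  show "edge_of ` set es \<subseteq> edges G"
    using friendly_build_subset[OF build] by (auto simp: edges_def)
qed

lemma edge_of_subset_walk: "e \<in> path_edges p \<Longrightarrow> e \<subseteq> set p"
  by (induction p rule: vwalk_arcs.induct) (auto simp: path_edges_def edge_of_def)

text \<open>Each edge of the path toggles exactly its own number, and a simple path repeats no edge,
  so nothing cancels.\<close>

lemma anc_vpath:
  assumes "friendly_build P r es" "edges G = edge_of ` set es" "vpath p (with_proj G)"
  shows "anc es (hd p) i \<noteq> anc es (last p) i \<longleftrightarrow>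
    i \<in> {1..int (length es)} \<and> numbering es i \<in> path_edges p"
  using assms(3)
proof (induction p rule: vwalk_arcs.induct)
  case (3 x y p)
  then have arc: "(x, y) \<in> parcs G" and vp: "vpath (y # p) (with_proj G)" and x: "x \<notin> set (y # p)"
    by (auto simp: vpath_def vwalk_def)
  from arc have "{x, y} \<in> edges G" by (force simp: edges_def edge_of_def)
  then obtain j where j: "j \<in> {1..int (length es)}" "numbering es j = {x, y}"
    unfolding assms(2) numbering_image[symmetric] by force
  have new: "{x, y} \<notin> path_edges (y # p)" using x edge_of_subset_walk by blast
  have xy: "anc es x i \<noteq> anc es y i \<longleftrightarrow> i = j"
    using j by (intro anc_edge[OF assms(1)]) auto
  have IH: "anc es y i \<noteq> anc es (last (y # p)) i \<longleftrightarrow>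
    i \<in> {1..int (length es)} \<and> numbering es i \<in> path_edges (y # p)"
    using "3.IH"[OF vp] by simp
  have path: "path_edges (x # y # p) = insert {x, y} (path_edges (y # p))"
    by (simp add: path_edges_def edge_of_def)
  have last: "hd (x # y # p) = x" "last (x # y # p) = last (y # p)" by simp_all
  show ?case
  proof (cases "i = j")
    case True
    then have "numbering es i = {x, y}" "i \<in> {1..int (length es)}" using j by simp_all
    with True show ?thesis using xy IH new unfolding path last by auto
  next
    case False
    then have "numbering es i \<noteq> {x, y}" if "i \<in> {1..int (length es)}"
      using that j inj_onD[OF inj_on_numbering[OF assms(1)], of i j] by auto
    with False show ?thesis using xy IH unfolding path last by blast
  qed
qed (auto simp: vpath_def vwalk_def path_edges_def)

text \<open>By \<open>anc_vpath\<close> the required property becomes a \<open>sim\<close> between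
  the ends of \<open>q\<close>. Since \<open>q\<close> avoids edges \<open>k\<close> and
  \<open>k + 1\<close>, it is trivial at \<open>w = u'\<close> or runs from \<open>u\<close> to
  \<open>u'\<close>, where \<open>jump\<close> applies.\<close>

lemma friendly_if_friendly_build:
  assumes tree: "undirected_tree G" and build: "friendly_build (parcs G) r es"
    and "built r es = pverts G"
  shows "friendly_to_simple_path G"
proof -
  let ?n = "int (length es)" and ?\<epsilon> = "numbering es"
  have edges: "edges G = edge_of ` set es" by (rule edges_build[OF assms])
  have bij: "bij_betw ?\<epsilon> {1..?n} (edges G)"
    using inj_on_numbering[OF build] by (simp add: bij_betw_def numbering_image edges)
  then have card: "int (card (edges G)) = ?n"
    using bij_betw_same_card[OF bij] by simp
  have "contains_number G ?\<epsilon> (path_between G (?\<epsilon> k) (?\<epsilon> (k + 1))) (k + 2 * s) \<longleftrightarrow>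
    contains_number G ?\<epsilon> (path_between G (?\<epsilon> k) (?\<epsilon> (k + 1))) (k + 2 * s + 1)"
    if k: "1 \<le> k" "k < ?n" for k s
  proof -
    define q where "q = path_between G (?\<epsilon> k) (?\<epsilon> (k + 1))"
    have "?\<epsilon> k \<in> edges G" "?\<epsilon> (k + 1) \<in> edges G"
      using bij k by (auto simp: bij_betw_def)
    moreover have "?\<epsilon> k \<noteq> ?\<epsilon> (k + 1)"
      using inj_onD[OF inj_on_numbering[OF build], of k "k + 1"] k by auto
    ultimately have "joins_edges G (?\<epsilon> k) (?\<epsilon> (k + 1)) q"
      unfolding q_def path_between_def by (rule theI'[OF joins_edges_ex1[OF tree]])
    then have q: "vpath q (with_proj G)" "hd q \<in> ?\<epsilon> k" "last q \<in> ?\<epsilon> (k + 1)"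
      "?\<epsilon> k \<notin> path_edges q" "?\<epsilon> (k + 1) \<notin> path_edges q"
      by (auto simp: joins_edges_def)
    have contains: "contains_number G ?\<epsilon> q i \<longleftrightarrow> anc es (hd q) i \<noteq> anc es (last q) i" for i
      using anc_vpath[OF build edges q(1)] card by (simp add: contains_number_def)
    have "1 \<le> k + 1" "k + 1 \<le> ?n" using k by simp_all
    then obtain fs u' w' es1 where es1': "es = fs @ (u', w') # es1" "k + 1 = int (length es1) + 1"
      by (rule list_split_at)
    then have es1: "es = fs @ (u', w') # es1" "k = int (length es1)" by simp_all
    then obtain u w es0 where es0: "es1 = (u, w) # es0" using k by (cases es1) auto
    have good1: "friendly_build (parcs G) r ((u', w') # es1)"
      using build unfolding es1(1) by (rule friendly_build_suffix)
    have anc1: "anc es x = anc es1 x" if "x \<in> built r es1" for x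
      using anc_suffix[of "parcs G" r "fs @ [(u', w')]" es1] build es1(1) that by simp
    have mem: "u \<in> built r es1" "w \<in> built r es1" "u' \<in> built r es1" "w' \<notin> built r es1"
      using good1 es0 by auto
    have \<epsilon>: "?\<epsilon> k = {u, w}" "?\<epsilon> (k + 1) = {u', w'}"
      using numbering_append[of fs u' w' es1] numbering_append[of "fs @ [(u', w')]" u w es0] es1 es0
      by (auto simp: add.commute)
    have notin: "anc es (hd q) k = anc es (last q) k" "anc es (hd q) (k + 1) = anc es (last q) (k + 1)"
      using contains q(4,5) by (auto simp: contains_number_def)
    have small: "\<not> anc es x (k + 1)" if "x \<in> built r es1" for x
      using anc1[OF that] anc_range[of es1 x "k + 1"] es1(2) by auto
    have hd_q: "hd q \<in> built r es1" using q(2) \<epsilon>(1) mem(1,2) by auto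
    \<comment> \<open>Ending at the new vertex \<open>w'\<close> would force \<open>q\<close> to
      cross edge \<open>k + 1\<close>.\<close>
    have last: "last q = u'"
    proof (rule ccontr)
      assume "last q \<noteq> u'"
      then have "last q = w'" using q(3) \<epsilon>(2) by auto
      moreover have "anc es u' (k + 1) \<noteq> anc es w' (k + 1)"
        using anc_edge[OF build _ _ \<epsilon>(2), of "k + 1"] k by linarith
      ultimately show False
        using notin(2) small[OF mem(3)] small[OF hd_q] by simp
    qed
    \<comment> \<open>Right after arc \<open>k\<close> is added, \<open>w\<close> is a leaf, so it
      alone has \<open>k\<close> on its way to the root.\<close>
    have only_w: "x = w" if "x \<in> built r es1" "anc es x k" for x
      using that anc1[OF that(1)] anc_range[of es0 x k] es0 es1(2) by (auto split: if_splits)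
    have "u \<noteq> w" using good1 es0 by auto
    have "anc es u k \<noteq> anc es w k" using anc_edge[OF build _ _ \<epsilon>(1), of k] k by simp
    then have w: "anc es w k" using only_w[OF mem(1)] \<open>u \<noteq> w\<close> by blast
    have "sim k (anc es (hd q)) (anc es (last q))"
    \<comment> \<open>The ends of \<open>q\<close> agree at \<open>k\<close>, so
      \<open>hd q = w\<close> exactly when \<open>u' = w\<close>; this selects the disjunct of
      \<open>jump\<close>.\<close>
    proof (cases "hd q = w")
      case True
      then have "u' = w" using only_w[OF mem(3)] w notin(1) last by simp
      then show ?thesis using True last by (simp add: sim_refl)
    next
      case False
      then have hd: "hd q = u" using q(2) \<epsilon>(1) by simp
      have "u' \<noteq> w" using hd notin(1) last w only_w[OF mem(1)] \<open>u \<noteq> w\<close> by auto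
      moreover have "jump es1 u'" using good1 by simp
      ultimately have "sim k (anc es1 u) (anc es1 u')" unfolding es0 using es1(2) es0 by (simp add: add.commute)
      then show ?thesis using last hd anc1[OF mem(1)] anc1[OF mem(3)] by simp
    qed
    then have "anc es (hd q) (k + 2 * s) \<noteq> anc es (last q) (k + 2 * s) \<longleftrightarrow>
        anc es (hd q) (k + 2 * s + 1) \<noteq> anc es (last q) (k + 2 * s + 1)"
      unfolding sim_def by (elim allE[of _ "k + 2 * s"]) simp
    then show ?thesis unfolding q_def[symmetric] contains .
  qed
  then show ?thesis
    unfolding friendly_to_simple_path_def card using bij by (intro exI[of _ ?\<epsilon>] conjI) blast+
qed

section \<open>Decomposition into a spine and its legs\<close>

text \<open>A system of legs covering the most vertices covers all: an arc leaving the covered set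
  starts on the spine or at the tip of a leg and so begins or prolongs a leg. Elsewhere on a leg it
  would give a vertex of degree at least 3 off the spine.\<close>

lemma exists_legs:
  assumes "pair_graph G" "connected (with_proj G)" "vpath vs (with_proj G)"
    and branch: "{v \<in> pverts G. 3 \<le> out_degree (with_proj G) v} \<subseteq> set vs"
  shows "\<exists>L. (\<forall>x\<in>set vs. legs (parcs G) (set vs) x (L x)) \<and>
    (\<forall>x\<in>set vs. \<forall>y\<in>set vs. x \<noteq> y \<longrightarrow> (\<forall>xs\<in>L x. \<forall>ys\<in>L y. set xs \<inter> set ys = {})) \<and>
    set vs \<union> (\<Union>x\<in>set vs. \<Union>(set ` L x)) = pverts G"
proof -
  interpret pair_graph G by fact
  have sym: "(b, a) \<in> parcs G" if "(a, b) \<in> parcs G" for a b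
    using that pair_sym_arcs by (auto simp: symmetric_def sym_def)
  have vs: "vs \<noteq> []" "set vs \<subseteq> pverts G" "distinct vs"
    using assms(3) by (auto simp: vpath_def vwalk_def)
  define covered where "covered L = set vs \<union> (\<Union>x\<in>set vs. \<Union>(set ` L x))" for L :: "'a \<Rightarrow> 'a list set"
  define inv where "inv L \<longleftrightarrow> (\<forall>x\<in>set vs. legs (parcs G) (set vs) x (L x)) \<and>
    (\<forall>x\<in>set vs. \<forall>y\<in>set vs. x \<noteq> y \<longrightarrow> (\<forall>xs\<in>L x. \<forall>ys\<in>L y. set xs \<inter> set ys = {})) \<and>
    covered L \<subseteq> pverts G" for L
  have grow: "\<exists>L'. inv L' \<and> card (covered L) < card (covered L')"
    if L: "inv L" and nontotal: "covered L \<noteq> pverts G" for L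
  proof -
    have L_legs: "legs (parcs G) (set vs) x (L x)" if "x \<in> set vs" for x
      using L that by (simp add: inv_def)
    have L_disj: "set xs \<inter> set ys = {}"
      if "x \<in> set vs" "y \<in> set vs" "x \<noteq> y" "xs \<in> L x" "ys \<in> L y" for x y xs ys
      using L that by (simp add: inv_def)
    have L_sub: "covered L \<subseteq> pverts G" using L by (simp add: inv_def)
    \<comment> \<open>If no arc left the covered set, every vertex reachable from
      \<open>hd vs\<close> would lie in it.\<close>
    obtain u w where uw: "(u, w) \<in> parcs G" "u \<in> covered L" "w \<notin> covered L"
    proof (rule ccontr)
      assume "\<not> thesis"
      with that have closed: "\<And>u w. (u, w) \<in> parcs G \<Longrightarrow> u \<in> covered L \<Longrightarrow> w \<in> covered L"
        by blast
      obtain z where z: "z \<in> pverts G" "z \<notin> covered L" using nontotal L_sub by blast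
      have "mk_symmetric (with_proj G) = G"
      proof -
        have "(\<Union>e\<in>parcs G. {(fst e, snd e), (snd e, fst e)}) = parcs G"
          using sym by auto
        then show ?thesis by (simp add: mk_symmetric_def)
      qed
      moreover have "hd vs \<in> pverts G" using vs by (meson hd_in_set subsetD)
      ultimately have "hd vs \<rightarrow>\<^sup>*\<^bsub>with_proj G\<^esub> z"
        using assms(2) z(1) by (auto simp: connected_def strongly_connected_def)
      then have "(hd vs, z) \<in> (parcs G)\<^sup>*" using reachable_rtranclI[of "with_proj G"] by simp
      then have "z \<in> covered L"
      proof (induction rule: rtrancl_induct)
        case base
        show ?case using vs(1) by (simp add: covered_def)
      next
        case (step y z)
        then show ?case using closed by blast
      qed
      with z(2) show False ..
    qed
    have w: "w \<in> pverts G" using uw(1) by (rule in_arcsD2)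
    \<comment> \<open>The case \<open>xs = []\<close> starts a new leg; otherwise an existing one
      gets longer.\<close>
    have "\<exists>x\<in>set vs. \<exists>xs. (xs = [] \<or> xs \<in> L x) \<and> leg (parcs G) x (xs @ [w])"
    proof (cases "u \<in> set vs")
      case True
      with uw(1) show ?thesis by (intro bexI[of _ u] exI[of _ "[]"]) (simp_all add: leg_def)
    next
      case False
      then obtain x xs where x: "x \<in> set vs" "xs \<in> L x" "u \<in> set xs"
        using uw(2) by (auto simp: covered_def)
      have xs: "leg (parcs G) x xs" "set xs \<inter> set vs = {}"
        using L_legs[OF x(1)] x(2) by (auto simp: legs_def)
      have wxs: "w \<notin> set xs" using x uw(3) by (auto simp: covered_def)
      have wx: "w \<noteq> x" using x uw(3) by (auto simp: covered_def)
      obtain as bs where split: "xs = as @ u # bs" using x(3) by (meson split_list)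
      have "bs = []"
      proof (rule ccontr)
        assume "bs \<noteq> []"
        then obtain c bs' where bs: "bs = c # bs'" by (cases bs) auto
        \<comment> \<open>The neighbour of \<open>u\<close> towards the spine, which is
          \<open>x\<close> itself if \<open>u\<close> is first on its leg.\<close>
        define d where "d = last (x # as)"
        have arcs: "(d, u) \<in> parcs G" "(u, c) \<in> parcs G"
          using xs(1) split bs unfolding leg_def d_def
          by (auto simp: successively_append_iff successively_Cons split: if_splits)
        have dset: "d \<in> insert x (set as)" unfolding d_def by auto
        have "x \<notin> set xs" using x(1) xs(2) by auto
        then have "d \<noteq> c" "c \<noteq> w" "d \<noteq> w"
          using dset xs(1) split bs wxs wx by (auto simp: leg_def)
        then have "card {(u, d), (u, c), (u, w)} = 3" by simp
        moreover have "{(u, d), (u, c), (u, w)} \<subseteq> out_arcs (with_proj G) u"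
          using arcs sym uw(1) by (auto simp: out_arcs_def)
        moreover have "finite (out_arcs (with_proj G) u)"
          using pair_finite_arcs by (simp add: out_arcs_def)
        ultimately have "3 \<le> out_degree (with_proj G) u"
          unfolding out_degree_def by (metis card_mono)
        with branch in_arcsD1[OF uw(1)] False show False by auto
      qed
      then have "last (x # xs) = u" using split by simp
      then have "successively (\<lambda>a b. (a, b) \<in> parcs G) ((x # xs) @ [w])"
        using xs(1) uw(1) unfolding successively_append_iff by (simp add: leg_def)
      then have "leg (parcs G) x (xs @ [w])"
        using xs(1) wxs by (simp add: leg_def)
      with x show ?thesis by blast
    qed
    then obtain x xs where x: "x \<in> set vs" "xs = [] \<or> xs \<in> L x" "leg (parcs G) x (xs @ [w])"
      by blast
    let ?xs = "xs @ [w]"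
    \<comment> \<open>Legs are nonempty, so for a new leg, with \<open>xs = []\<close>, the removal
      changes nothing.\<close>
    define L' where "L' = L(x := insert ?xs (L x - {xs}))"
    have xs_cov: "set xs \<subseteq> covered L" using x(1,2) by (auto simp: covered_def)
    have w_new: "w \<notin> set vs" "\<And>y ys. y \<in> set vs \<Longrightarrow> ys \<in> L y \<Longrightarrow> w \<notin> set ys"
      using uw(3) by (auto simp: covered_def)
    have xs_vs: "set xs \<inter> set vs = {}" using x(1,2) L_legs[OF x(1)] by (auto simp: legs_def)
    have xs_disj: "set ?xs \<inter> set ys = {}" if "y \<in> set vs" "ys \<in> L y" "(y, ys) \<noteq> (x, xs)" for y ys
    proof -
      have "set xs \<inter> set ys = {}"
      proof (cases "y = x")
        case True
        then have "xs = [] \<or> xs \<in> L x \<and> ys \<in> L x \<and> ys \<noteq> xs" using x(2) that by auto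
        then show ?thesis using L_legs[OF x(1)] unfolding legs_def by (metis Int_empty_left empty_set)
      next
        case False
        then show ?thesis using x(1,2) L_disj[of x y xs ys] that by auto
      qed
      with w_new(2)[OF that(1,2)] show ?thesis by simp
    qed
    have "legs (parcs G) (set vs) y (L' y)" if y: "y \<in> set vs" for y
    proof (cases "y = x")
      case True
      have fin: "finite (L x)"
        and old: "\<And>ys. ys \<in> L x \<Longrightarrow> leg (parcs G) x ys \<and> set ys \<inter> set vs = {}"
        and dis: "\<And>ys zs. ys \<in> L x \<Longrightarrow> zs \<in> L x \<Longrightarrow> ys \<noteq> zs \<Longrightarrow> set ys \<inter> set zs = {}"
        using L_legs[OF x(1)] by (simp_all add: legs_def)
      have new: "set ?xs \<inter> set ys = {}" if "ys \<in> L x - {xs}" for ys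
        using xs_disj[OF x(1), of ys] that by auto
      have L'x: "L' x = insert ?xs (L x - {xs})" by (simp add: L'_def)
      show ?thesis unfolding True legs_def L'x
      proof (intro conjI ballI impI)
        fix ys zs assume "ys \<in> insert ?xs (L x - {xs})" "zs \<in> insert ?xs (L x - {xs})" "ys \<noteq> zs"
        then show "set ys \<inter> set zs = {}"
          using dis[of ys zs] new[of ys] new[of zs] by (metis Diff_iff inf_commute insert_iff)
      qed (use fin old x(3) xs_vs w_new(1) in auto)
    next
      case False
      then show ?thesis using L_legs[OF y] by (simp add: L'_def)
    qed
    moreover have "set ys \<inter> set zs = {}"
      if "y \<in> set vs" "z \<in> set vs" "y \<noteq> z" "ys \<in> L' y" "zs \<in> L' z" for y z ys zs
    proof -
      have "ys \<in> L y \<or> y = x \<and> ys = ?xs" "zs \<in> L z \<or> z = x \<and> zs = ?xs"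
        using that(4,5) by (auto simp: L'_def split: if_splits)
      then show ?thesis
        using L_disj[OF that(1-3), of ys zs] xs_disj[OF that(1), of ys] xs_disj[OF that(2), of zs]
          that(3) by (metis Pair_inject inf_commute)
    qed
    moreover have cov: "covered L' = insert w (covered L)"
    proof
      have sub: "set ys \<subseteq> insert w (covered L)" if "y \<in> set vs" "ys \<in> L' y" for y ys
      proof (cases "ys \<in> L y")
        case True
        then show ?thesis using that(1) by (auto simp: covered_def)
      next
        case False
        then have "ys = ?xs" using that(2) by (auto simp: L'_def split: if_splits)
        moreover have "set ?xs \<subseteq> insert w (covered L)"
          using subset_insertI2[OF xs_cov] by simp
        ultimately show ?thesis by simp
      qed
      have "set vs \<subseteq> insert w (covered L)" by (auto simp: covered_def)
      then show "covered L' \<subseteq> insert w (covered L)"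
        unfolding covered_def[of L'] using sub by (intro Un_least UN_least)
      have "set ys \<subseteq> covered L'" if "y \<in> set vs" "ys \<in> L y" for y ys
      proof (cases "y = x \<and> ys = xs")
        case True
        then show ?thesis using x(1) by (auto simp: covered_def L'_def)
      next
        case False
        then have "ys \<in> L' y" using that by (auto simp: L'_def)
        then show ?thesis using that(1) by (auto simp: covered_def)
      qed
      moreover have "w \<in> covered L'" using x(1) by (auto simp: covered_def L'_def)
      ultimately show "insert w (covered L) \<subseteq> covered L'"
        by (auto simp: covered_def)
    qed
    moreover have "covered L' \<subseteq> pverts G" using cov L_sub w by simp
    moreover have "finite (covered L)" using L_sub pair_finite_verts finite_subset by blast
    ultimately show ?thesis using uw(3)
      by (intro exI[of _ L']) (simp add: inv_def)
  qed
  \<comment> \<open>The system without legs is admissible and \<open>card (pverts G)\<close> bounds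
    the coverage, so a maximal system exists.\<close>
  have "inv (\<lambda>_. {})" using vs(2) by (simp add: inv_def covered_def legs_def)
  moreover have "card (covered L) < Suc (card (pverts G))" if "inv L" for L
    using that card_mono[OF pair_finite_verts] by (simp add: inv_def less_Suc_eq_le)
  ultimately obtain L where L: "inv L" "\<And>L'. inv L' \<Longrightarrow> card (covered L') \<le> card (covered L)"
    using ex_has_greatest_nat[of inv "\<lambda>_. {}" "\<lambda>L. card (covered L)" "Suc (card (pverts G))"] by metis
  have "covered L = pverts G"
    using grow[OF L(1)] L(2) by (meson leD)
  with L(1) show ?thesis
    unfolding inv_def covered_def by (intro exI[of _ L]) simp
qed

theorem mainTheorem1:
  fixes G :: "'a pair_pre_digraph"
  assumes "undirected_tree G"
    and "\<exists>p. vpath p (with_proj G) \<and> {v \<in> pverts G. 3 \<le> out_degree (with_proj G) v} \<subseteq> set p"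
  shows "friendly_to_simple_path G"
proof -
  obtain p where p: "vpath p (with_proj G)"
    "{v \<in> pverts G. 3 \<le> out_degree (with_proj G) v} \<subseteq> set p"
    using assms(2) by blast
  \<comment> \<open>The first vertex of the path becomes the root of the build.\<close>
  obtain r vs where rvs: "p = r # vs"
    using p(1) by (cases p) (auto simp: vpath_def vwalk_def)
  have "pair_graph G" "connected (with_proj G)"
    using assms(1) by (simp_all add: undirected_tree_def)
  from exists_legs[OF this p] obtain L
    where legs: "\<forall>x\<in>set p. legs (parcs G) (set p) x (L x)"
      and disjoint: "\<forall>x\<in>set p. \<forall>y\<in>set p. x \<noteq> y \<longrightarrow>
        (\<forall>xs\<in>L x. \<forall>ys\<in>L y. set xs \<inter> set ys = {})"
      and cover: "set p \<union> (\<Union>x\<in>set p. \<Union>(set ` L x)) = pverts G"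
    by (elim exE conjE)
  have succ: "successively (\<lambda>a b. (a, b) \<in> parcs G) p"
  proof -
    have "set (vwalk_arcs p) \<subseteq> parcs G \<Longrightarrow> successively (\<lambda>a b. (a, b) \<in> parcs G) p" for p
      by (induction p rule: vwalk_arcs.induct) auto
    then show ?thesis using p(1) by (simp add: vpath_def vwalk_def)
  qed
  have dist: "distinct p" using p(1) by (simp add: vpath_def)
  have start: "built r [] \<union> set vs = set p" using rvs by simp
  have "\<exists>es. friendly_build (parcs G) r es \<and>
      built r es = built r [] \<union> set vs \<union> (\<Union>x\<in>set (r # vs). \<Union>(set ` L x))"
  \<comment> \<open>The build starts from the empty list, where \<open>jump\<close> holds
    trivially.\<close>
  proof (rule spine_with_legs)
    show "legs (parcs G) (built r [] \<union> set vs) x (L x)" if "x \<in> set (r # vs)" for x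
      unfolding start using that rvs legs by metis
    show "set xs \<inter> set ys = {}" if "x \<in> set (r # vs)" "y \<in> set (r # vs)" "x \<noteq> y"
      "xs \<in> L x" "ys \<in> L y" for x y xs ys
      using disjoint that unfolding rvs by blast
  qed (use succ dist rvs in simp_all)
  then obtain es where "friendly_build (parcs G) r es" "built r es = pverts G"
    using cover rvs by auto
  then show ?thesis by (rule friendly_if_friendly_build[OF assms(1)])
qed

end
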